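(* Let $A\in\mathbb{Z}^{n\times n}$ and let $p$ be any prime. There exist $P,Q\in \mathrm{GL}_n(\mathbb{Z})$ such that $PAQ$ is $p$-correspondent.
   Context: Let $p$ be a prime. $v_p$ denotes the $p$-adic valuation on $\mathbb{Q}_p\supseteq\mathbb{Q}$ (with $v_p(0)=\infty$), extended to any finite-degree extension $K_p$ of $\mathbb{Q}_p$ as follows: if $a\in K_p$ has minimal polynomial $x^{d}+a_{d-1}x^{d-1}+\cdots+a_0$ over $\mathbb{Q}_p$, then $v_p(a)=\frac1d v_p(a_0)$. Let $M\in\mathbb{Z}^{n\times n}$ have rank $r$. Its Smith normal form over $\mathbb{Z}$ is $\operatorname{diag}(s_1,\ldots,s_r,0,\ldots,0)$ with nonzero invariant factors $s_1\mid s_2\mid\cdots\mid s_r$. $M$ is called $p$-correspondent if $M$ has exactly $r$ non-zero eigenvalues (counted with algebraic multiplicity) $\lambda_1,\ldots,\lambda_r$ in a finite-degree extension $K_p$ of $\mathbb{Q}_p$ and, when they are ordered so that $v_p(\lambda_1)\le\cdots\le v_p(\lambda_r)$, one has $v_p(s_i)=v_p(\lambda_i)$ for all $i\in\{1,\ldots,r\}$. *)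

theory Defs
  imports
    "HOL-Library.Extended_Real"
    "HOL-Algebra.Finite_Extensions"
    "Jordan_Normal_Form.Char_Poly"
    "Jordan_Normal_Form.DL_Rank"
begin

section \<open>The field of p-adic numbers\<close>

definition padic_val :: "nat \<Rightarrow> rat \<Rightarrow> ereal" where
  "padic_val p x =
     (if x = 0 then \<infinity>
      else ereal (real (multiplicity (int p) (fst (quotient_of x)))
                - real (multiplicity (int p) (snd (quotient_of x)))))"

text \<open>
  The p-adic numbers are the completion of the rationals: the ring of p-adic Cauchy sequences
  modulo the ideal of null sequences.
\<close>

definition padic_cauchy :: "nat \<Rightarrow> (nat \<Rightarrow> rat) set" where
  "padic_cauchy p = {u. \<forall>N::nat. \<exists>m. \<forall>i\<ge>m. \<forall>j\<ge>m. ereal (real N) \<le> padic_val p (u i - u j)}"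

definition padic_null :: "nat \<Rightarrow> (nat \<Rightarrow> rat) set" where
  "padic_null p = {u. (\<lambda>i. padic_val p (u i)) \<longlonglongrightarrow> \<infinity>}"

definition padic_cauchy_ring :: "nat \<Rightarrow> (nat \<Rightarrow> rat) ring" where
  "padic_cauchy_ring p =
     \<lparr>carrier = padic_cauchy p,
      monoid.mult = (\<lambda>u w i. u i * w i), one = (\<lambda>_. 1),
      zero = (\<lambda>_. 0), add = (\<lambda>u w i. u i + w i)\<rparr>"

type_synonym padic = "(nat \<Rightarrow> rat) set"

definition Qp :: "nat \<Rightarrow> padic ring" where
  "Qp p = padic_cauchy_ring p Quot padic_null p"

text \<open>
  Along a Cauchy sequence the valuation converges in the extended reals (it is eventually
  constant unless the sequence is null), and the limit depends only on the class.
\<close>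

definition Qp_val :: "nat \<Rightarrow> padic \<Rightarrow> ereal" where
  "Qp_val p x = (THE v. \<forall>u\<in>x. (\<lambda>i. padic_val p (u i)) \<longlonglongrightarrow> v)"


section \<open>Finite extensions and the extended valuation\<close>

text \<open>A finite extension is a field K together with an embedding e of the p-adic numbers.\<close>

definition finite_Qp_extension :: "nat \<Rightarrow> ('k, 'm) ring_scheme \<Rightarrow> (padic \<Rightarrow> 'k) \<Rightarrow> bool" where
  "finite_Qp_extension p K e \<longleftrightarrow>
     field K \<and> e \<in> Ring.ring_hom (Qp p) K \<and>
     ring.finite_dimension K (e ` carrier (Qp p)) (carrier K)"

definition ext_val :: "nat \<Rightarrow> ('k, 'm) ring_scheme \<Rightarrow> (padic \<Rightarrow> 'k) \<Rightarrow> 'k \<Rightarrow> ereal" where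
  "ext_val p K e a =
     (let f = ring.Irr K (e ` carrier (Qp p)) a in
      ereal (1 / real (Polynomials.degree f)) *
        Qp_val p (inv_into (carrier (Qp p)) e (ring.const_term K f)))"


section \<open>Correspondence of integer matrices\<close>

definition GL_int :: "nat \<Rightarrow> int mat set" where
  "GL_int n = {P \<in> carrier_mat n n. invertible_mat P}"

definition smith_diag :: "nat \<Rightarrow> int list \<Rightarrow> int mat" where
  "smith_diag n s = mat n n (\<lambda>(i, j). if i = j \<and> i < length s then s ! i else 0)"

text \<open>Positivity makes the list of invariant factors unique.\<close>

definition invariant_factors :: "int mat \<Rightarrow> int list \<Rightarrow> bool" where
  "invariant_factors M s \<longleftrightarrow>
     length s \<le> dim_row M \<and>
     (\<forall>i<length s. 0 < s ! i) \<and>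
     (\<forall>i. Suc i < length s \<longrightarrow> s ! i dvd s ! Suc i) \<and>
     (\<exists>U\<in>GL_int (dim_row M). \<exists>V\<in>GL_int (dim_row M). U * M * V = smith_diag (dim_row M) s)"

definition int_rank :: "int mat \<Rightarrow> nat" where
  "int_rank M = vec_space.rank (dim_row M) (map_mat rat_of_int M)"

text \<open>
  The image in K of the characteristic polynomial, as a coefficient list with the leading
  coefficient first.
\<close>

definition char_poly_over :: "('k, 'm) ring_scheme \<Rightarrow> int mat \<Rightarrow> 'k list" where
  "char_poly_over K M = map (\<lambda>c. [c] \<cdot>\<^bsub>K\<^esub> \<one>\<^bsub>K\<^esub>) (rev (coeffs (char_poly M)))"

definition nonzero_eigenvalues :: "('k, 'm) ring_scheme \<Rightarrow> int mat \<Rightarrow> 'k multiset" where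
  "nonzero_eigenvalues K M = {#x \<in># ring.roots K (char_poly_over K M). x \<noteq> \<zero>\<^bsub>K\<^esub>#}"

text \<open>
  A finite extension of the p-adic numbers has the cardinality of the continuum, so up to
  isomorphism its carrier is a subset of the type of K below.
\<close>

definition p_correspondent :: "nat \<Rightarrow> int mat \<Rightarrow> bool" where
  "p_correspondent p M \<longleftrightarrow>
     (\<exists>(K :: padic ring) e s ls.
        finite_Qp_extension p K e \<and>
        invariant_factors M s \<and> length s = int_rank M \<and>
        mset ls = nonzero_eigenvalues K M \<and> length ls = int_rank M \<and>
        sorted (map (ext_val p K e) ls) \<and>
        (\<forall>i<int_rank M. padic_val p (rat_of_int (s ! i)) = ext_val p K e (ls ! i)))"

end

theory Submission
  imports Defs "Jordan_Normal_Form.Column_Operations"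
begin

text \<open>
  The matrices \<open>P\<close> and \<open>Q\<close> can be chosen to bring \<open>A\<close> into Smith normal form. A diagonal matrix
  \<open>diag(s\<^sub>1, \<dots>, s\<^sub>r, 0, \<dots>, 0)\<close> is its own Smith normal form when the \<open>s\<^sub>i\<close> form a divisibility chain
  of positive integers, and its characteristic polynomial is the product of the \<open>x - s\<^sub>i\<close> and a
  power of \<open>x\<close>. So the nonzero eigenvalues are exactly the invariant factors, they lie in the p-adic
  numbers already, and \<open>s\<^sub>i dvd s\<^bsub>i+1\<^esub>\<close> puts their valuations in increasing order.

  Two ingredients carry this. The existence of the Smith normal form
  (\<open>smith_normal_form_exists\<close>) is proved by minimality rather than by an algorithm: an entry of least
  absolute value among all matrices equivalent to \<open>A\<close> must divide everything it can be reduced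
  against. The p-adic numbers, constructed as Cauchy sequences modulo null sequences, are shown to
  be a field (\<open>Qp_field\<close>) in which the valuation of a rational number is the expected one
  (\<open>Qp_val_of_rat\<close>). For an integer in this field the minimal polynomial is linear, so the extended
  valuation is the p-adic valuation of the integer (\<open>ext_val_Qp_of_int\<close>).
\<close>


section \<open>The Smith normal form of an integer matrix\<close>

lemma GL_intI:
  assumes "P \<in> carrier_mat n n" "P' \<in> carrier_mat n n" "P * P' = 1\<^sub>m n" "P' * P = 1\<^sub>m n"
  shows "P \<in> GL_int n"
  using assms by (auto simp: GL_int_def invertible_mat_def inverts_mat_def)

lemma GL_intE:
  assumes "P \<in> GL_int n"
  obtains P' where "P \<in> carrier_mat n n" "P' \<in> carrier_mat n n" "P * P' = 1\<^sub>m n" "P' * P = 1\<^sub>m n"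
proof -
  from assms obtain P' where P: "P \<in> carrier_mat n n" and
    i: "P * P' = 1\<^sub>m n" "P' * P = 1\<^sub>m (dim_row P')"
    by (auto simp: GL_int_def invertible_mat_def inverts_mat_def)
  have "dim_col P' = n" using arg_cong[OF i(1), of dim_col] by simp
  moreover have "dim_row P' = n" using arg_cong[OF i(2), of dim_col] P by simp
  ultimately show thesis using that[of P'] P i by auto
qed

lemma GL_int_carrier: "P \<in> GL_int n \<Longrightarrow> P \<in> carrier_mat n n"
  by (auto simp: GL_int_def)

lemma one_GL_int [simp]: "1\<^sub>m n \<in> GL_int n"
  by (rule GL_intI[of _ _ "1\<^sub>m n"]) auto

lemma mult_GL_int:
  assumes "P \<in> GL_int n" "Q \<in> GL_int n"
  shows "P * Q \<in> GL_int n"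
proof -
  obtain P' where P: "P \<in> carrier_mat n n" "P' \<in> carrier_mat n n" "P * P' = 1\<^sub>m n" "P' * P = 1\<^sub>m n"
    using assms(1) by (rule GL_intE)
  obtain Q' where Q: "Q \<in> carrier_mat n n" "Q' \<in> carrier_mat n n" "Q * Q' = 1\<^sub>m n" "Q' * Q = 1\<^sub>m n"
    using assms(2) by (rule GL_intE)
  have "P * Q * (Q' * P') = P * (Q * Q') * P'"
    using P(1,2) Q(1,2) by (simp add: assoc_mult_mat[of _ n n _ n _ n])
  moreover have "Q' * P' * (P * Q) = Q' * (P' * P) * Q"
    using P(1,2) Q(1,2) by (simp add: assoc_mult_mat[of _ n n _ n _ n])
  ultimately show ?thesis
    using P Q by (intro GL_intI[of _ _ "Q' * P'"]) auto
qed

text \<open>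
  Equivalence of integer matrices, with the original matrix held fixed: the row and column
  operations of the reduction below act on \<open>B\<close> while the statements keep referring to \<open>A\<close>.
\<close>

definition mat_equivalent :: "nat \<Rightarrow> int mat \<Rightarrow> int mat \<Rightarrow> bool" where
  "mat_equivalent n A B \<longleftrightarrow> (\<exists>P\<in>GL_int n. \<exists>Q\<in>GL_int n. B = P * A * Q)"

lemma mat_equivalent_refl:
  assumes "A \<in> carrier_mat n n"
  shows "mat_equivalent n A A"
  using assms unfolding mat_equivalent_def by (intro bexI[of _ "1\<^sub>m n"]) auto

lemma mat_equivalent_carrier:
  "A \<in> carrier_mat n n \<Longrightarrow> mat_equivalent n A B \<Longrightarrow> B \<in> carrier_mat n n"
  by (auto simp: mat_equivalent_def dest!: GL_int_carrier)

lemma mat_equivalent_mult: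
  assumes A: "A \<in> carrier_mat n n" and AB: "mat_equivalent n A B"
    and U: "U \<in> GL_int n" and V: "V \<in> GL_int n"
  shows "mat_equivalent n A (U * B * V)"
proof -
  from AB obtain P Q where P: "P \<in> GL_int n" and Q: "Q \<in> GL_int n" and B: "B = P * A * Q"
    unfolding mat_equivalent_def by blast
  have "U * B * V = (U * P) * A * (Q * V)"
    unfolding B using A P Q U V
    by (simp add: assoc_mult_mat[of _ n n _ n _ n] mult_carrier_mat[of _ n n _ n] GL_int_carrier)
  thus ?thesis unfolding mat_equivalent_def using mult_GL_int P Q U V by blast
qed

lemma mat_equivalent_mult_left:
  assumes "A \<in> carrier_mat n n" "mat_equivalent n A B" "U \<in> GL_int n"
  shows "mat_equivalent n A (U * B)"
  using mat_equivalent_mult[OF assms one_GL_int] mat_equivalent_carrier[OF assms(1,2)] assms(3)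
  by (simp add: GL_int_carrier)

lemma mat_equivalent_mult_right:
  assumes "A \<in> carrier_mat n n" "mat_equivalent n A B" "U \<in> GL_int n"
  shows "mat_equivalent n A (B * U)"
  using mat_equivalent_mult[OF assms(1,2) one_GL_int assms(3)] mat_equivalent_carrier[OF assms(1,2)]
  by (simp add: GL_int_carrier)

lemma addrow_mat_GL_int:
  assumes "k < n" "l < n" "k \<noteq> l"
  shows "addrow_mat n a k l \<in> GL_int n"
  using addrow_mat_inv[OF assms, of a] addrow_mat_inv[OF assms, of "- a"]
  by (intro GL_intI[of _ _ "addrow_mat n (- a) k l"]) auto

lemma swaprows_mat_GL_int:
  assumes "k < n" "l < n"
  shows "swaprows_mat n k l \<in> GL_int n"
  using swaprows_mat_inv[OF assms] by (intro GL_intI[of _ _ "swaprows_mat n k l"]) auto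

lemma uminus_one_GL_int: "- 1\<^sub>m n \<in> GL_int n"
  by (rule GL_intI[of _ _ "- 1\<^sub>m n"]) auto


lemma uminus_zero_mat: "- 0\<^sub>m k m = (0\<^sub>m k m :: int mat)"
  by (rule eq_matI) auto

lemma lower_unipotent_GL_int:
  assumes "U \<in> carrier_mat m k"
  shows "four_block_mat (1\<^sub>m k) (0\<^sub>m k m) U (1\<^sub>m m) \<in> GL_int (k + m)"
proof -
  have "four_block_mat (1\<^sub>m k) (0\<^sub>m k m) V (1\<^sub>m m) * four_block_mat (1\<^sub>m k) (0\<^sub>m k m) (- V) (1\<^sub>m m)
      = 1\<^sub>m (k + m)" if "V \<in> carrier_mat m k" for V :: "int mat"
    using that uminus_l_inv_mat[OF that] comm_add_mat[OF that, of "- V"]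
    by (subst mult_four_block_mat[of _ k k _ m _ m _ _ k _ m]) (auto simp: uminus_zero_mat)
  from this[of U] this[of "- U"] assms show ?thesis
    by (intro GL_intI[of _ _ "four_block_mat (1\<^sub>m k) (0\<^sub>m k m) (- U) (1\<^sub>m m)"]) auto
qed

lemma upper_unipotent_GL_int:
  assumes "U \<in> carrier_mat k m"
  shows "four_block_mat (1\<^sub>m k) U (0\<^sub>m m k) (1\<^sub>m m) \<in> GL_int (k + m)"
proof -
  have "four_block_mat (1\<^sub>m k) V (0\<^sub>m m k) (1\<^sub>m m) * four_block_mat (1\<^sub>m k) (- V) (0\<^sub>m m k) (1\<^sub>m m)
      = 1\<^sub>m (k + m)" if "V \<in> carrier_mat k m" for V :: "int mat"
    using that uminus_l_inv_mat[OF that] comm_add_mat[OF that, of "- V"]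
    by (subst mult_four_block_mat[of _ k k _ m _ m _ _ k _ m]) (auto simp: uminus_zero_mat)
  from this[of U] this[of "- U"] assms show ?thesis
    by (intro GL_intI[of _ _ "four_block_mat (1\<^sub>m k) (- U) (0\<^sub>m m k) (1\<^sub>m m)"]) auto
qed

lemma block_diag_mult:
  fixes A B C D :: "int mat"
  assumes "A \<in> carrier_mat k k" "B \<in> carrier_mat k k" "C \<in> carrier_mat m m" "D \<in> carrier_mat m m"
  shows "four_block_mat A (0\<^sub>m k m) (0\<^sub>m m k) C * four_block_mat B (0\<^sub>m k m) (0\<^sub>m m k) D
    = four_block_mat (A * B) (0\<^sub>m k m) (0\<^sub>m m k) (C * D)"
  using assms by (subst mult_four_block_mat[of _ k k _ m _ m _ _ k _ m]) auto

lemma block_diag_GL_int: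
  assumes "P \<in> GL_int m"
  shows "four_block_mat (1\<^sub>m k) (0\<^sub>m k m) (0\<^sub>m m k) P \<in> GL_int (k + m)"
proof -
  obtain P' where P: "P \<in> carrier_mat m m" "P' \<in> carrier_mat m m" "P * P' = 1\<^sub>m m" "P' * P = 1\<^sub>m m"
    using assms by (rule GL_intE)
  show ?thesis
    using P by (intro GL_intI[of _ _ "four_block_mat (1\<^sub>m k) (0\<^sub>m k m) (0\<^sub>m m k) P'"])
      (auto simp: block_diag_mult)
qed

text \<open>
  Block form of clearing a row and a column: when the first block row and block column are
  multiples of the corner \<open>C\<close>, multiplying by a lower unipotent matrix on the left and an upper
  unipotent matrix on the right removes both at once and leaves a Schur complement.
\<close>

lemma block_elimination:
  assumes A: "A \<in> carrier_mat (k + m) (k + m)"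
    and AB: "mat_equivalent (k + m) A (four_block_mat C (C * U) (V * C) Z)"
    and c: "C \<in> carrier_mat k k" "U \<in> carrier_mat k m" "V \<in> carrier_mat m k" "Z \<in> carrier_mat m m"
  shows "mat_equivalent (k + m) A (four_block_mat C (0\<^sub>m k m) (0\<^sub>m m k) (Z - V * (C * U)))"
proof -
  let ?L = "four_block_mat (1\<^sub>m k) (0\<^sub>m k m) (- V) (1\<^sub>m m)"
  let ?R = "four_block_mat (1\<^sub>m k) (- U) (0\<^sub>m m k) (1\<^sub>m m)"
  let ?D = "Z - V * (C * U)"
  have "?L * four_block_mat C (C * U) (V * C) Z
      = four_block_mat C (C * U) (- V * C + V * C) (- V * (C * U) + Z)"
    using c by (subst mult_four_block_mat[of _ k k _ m _ m _ _ k _ m]) auto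
  also have "- V * C + V * C = 0\<^sub>m m k"
    using c uminus_l_inv_mat[of "V * C" m k] by simp
  also have "- V * (C * U) + Z = ?D"
    using c by (intro eq_matI) auto
  finally have L: "?L * four_block_mat C (C * U) (V * C) Z = four_block_mat C (C * U) (0\<^sub>m m k) ?D" .
  have "four_block_mat C (C * U) (0\<^sub>m m k) ?D * ?R
      = four_block_mat C (C * (- U) + C * U) (0\<^sub>m m k) ?D"
    using c by (subst mult_four_block_mat[of _ k k _ m _ m _ _ k _ m]) auto
  also have "C * (- U) + C * U = 0\<^sub>m k m"
    using c uminus_l_inv_mat[of "C * U" k m] by simp
  finally have R: "four_block_mat C (C * U) (0\<^sub>m m k) ?D * ?R
      = four_block_mat C (0\<^sub>m k m) (0\<^sub>m m k) ?D" .
  have "mat_equivalent (k + m) A (?L * four_block_mat C (C * U) (V * C) Z * ?R)"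
    using A AB c by (intro mat_equivalent_mult lower_unipotent_GL_int upper_unipotent_GL_int) auto
  thus ?thesis unfolding L R .
qed

lemma dvd_mat_mult_entries:
  fixes A B :: "int mat"
  assumes "i < dim_row A" "j < dim_col B" "dim_col A = dim_row B"
    and "(\<forall>k<dim_row B. d dvd A $$ (i, k)) \<or> (\<forall>k<dim_row B. d dvd B $$ (k, j))"
  shows "d dvd (A * B) $$ (i, j)"
  using assms by (auto simp: scalar_prod_def intro!: dvd_sum intro: dvd_mult dvd_mult2)

text \<open>
  The bound concerns the entries of all matrices equivalent to \<open>A\<close>, not only those of \<open>A\<close>. Once \<open>d\<close>
  is attained, this replaces the termination argument of the elimination algorithm: a division by
  \<open>d\<close> that row or column operations can realise must have remainder zero, since a nonzero remainder
  would be a smaller entry.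
\<close>

definition least_pivot :: "nat \<Rightarrow> int mat \<Rightarrow> int \<Rightarrow> bool" where
  "least_pivot n A d \<longleftrightarrow> 0 < d \<and>
    (\<forall>B i j. mat_equivalent n A B \<longrightarrow> i < n \<longrightarrow> j < n \<longrightarrow> B $$ (i, j) \<noteq> 0 \<longrightarrow> d \<le> \<bar>B $$ (i, j)\<bar>)"

text \<open>
  Some equivalent matrix attains the minimal absolute value at some position; two swaps bring
  that entry to the top left corner and multiplication by \<open>-1\<close> makes it positive.
\<close>

lemma exists_least_pivot:
  assumes A: "A \<in> carrier_mat n n" and nz: "A \<noteq> 0\<^sub>m n n"
  shows "\<exists>B d. mat_equivalent n A B \<and> B $$ (0, 0) = d \<and> least_pivot n A d"
proof -
  define S where "S = {nat \<bar>B $$ (i, j)\<bar> | B i j.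
    mat_equivalent n A B \<and> i < n \<and> j < n \<and> B $$ (i, j) \<noteq> 0}"
  obtain i0 j0 where "i0 < n" "j0 < n" "A $$ (i0, j0) \<noteq> 0"
    using A nz by (metis carrier_matD(1,2) eq_matI index_zero_mat)
  hence "nat \<bar>A $$ (i0, j0)\<bar> \<in> S"
    unfolding S_def using mat_equivalent_refl[OF A] by blast
  then have "(LEAST x. x \<in> S) \<in> S" by (rule LeastI)
  then obtain B i j where B: "mat_equivalent n A B" and ij: "i < n" "j < n" "B $$ (i, j) \<noteq> 0"
    and least: "(LEAST x. x \<in> S) = nat \<bar>B $$ (i, j)\<bar>"
    unfolding S_def by blast
  define d where "d = \<bar>B $$ (i, j)\<bar>"
  have min: "d \<le> \<bar>C $$ (k, l)\<bar>"
    if "mat_equivalent n A C" "k < n" "l < n" "C $$ (k, l) \<noteq> 0" for C k l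
  proof -
    have "nat \<bar>C $$ (k, l)\<bar> \<in> S" unfolding S_def using that by blast
    from Least_le[of "\<lambda>x. x \<in> S", OF this] show ?thesis unfolding least d_def by linarith
  qed
  have lp: "least_pivot n A d" using min ij(3) unfolding least_pivot_def d_def by auto
  have n: "0 < n" using ij by simp
  have Bc: "B \<in> carrier_mat n n" using mat_equivalent_carrier[OF A B] .
  define C where "C = swaprows_mat n 0 i * B * swaprows_mat n 0 j"
  have C: "mat_equivalent n A C"
    unfolding C_def by (intro mat_equivalent_mult A B swaprows_mat_GL_int n ij)
  have Cc: "C \<in> carrier_mat n n" using mat_equivalent_carrier[OF A C] .
  have "C = swapcols 0 j (swaprows 0 i B)"
    unfolding C_def using Bc n ij
    by (subst swapcols_mat[of _ n n]) (auto simp: swaprows_mat[of _ n n])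
  hence C0: "C $$ (0, 0) = B $$ (i, j)" using Bc n ij by auto
  show ?thesis
  proof (cases "B $$ (i, j) > 0")
    case True
    thus ?thesis using C C0 lp unfolding d_def by auto
  next
    case False
    have "mat_equivalent n A (- 1\<^sub>m n * C)"
      by (rule mat_equivalent_mult_left[OF A C uminus_one_GL_int])
    moreover have "- 1\<^sub>m n * C = - C" using Cc by simp
    moreover have "(- C) $$ (0, 0) = d" using False C0 Cc n by (simp add: d_def)
    ultimately show ?thesis using lp by metis
  qed
qed

text \<open>
  Subtracting a multiple of row 0 replaces the entry by its remainder modulo \<open>d\<close>, which is too
  small to be a nonzero entry of an equivalent matrix.
\<close>

lemma least_pivot_dvd_column:
  assumes A: "A \<in> carrier_mat n n" and lp: "least_pivot n A d"
    and B: "mat_equivalent n A B" and d: "B $$ (0, 0) = d" and i: "i < n"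
  shows "d dvd B $$ (i, 0)"
proof (cases "i = 0")
  case False
  define q where "q = B $$ (i, 0) div d"
  have Bc: "B \<in> carrier_mat n n" using mat_equivalent_carrier[OF A B] .
  have d0: "0 < d" using lp by (simp add: least_pivot_def)
  have "mat_equivalent n A (addrow_mat n (- q) i 0 * B)"
    using False i by (intro mat_equivalent_mult_left A B addrow_mat_GL_int) auto
  moreover have "addrow_mat n (- q) i 0 * B = addrow (- q) i 0 B"
    using i by (subst addrow_mat[OF Bc]) auto
  moreover have "addrow (- q) i 0 B $$ (i, 0) = B $$ (i, 0) mod d"
    using i Bc d by (simp add: q_def minus_div_mult_eq_mod[symmetric])
  ultimately have "B $$ (i, 0) mod d = 0 \<or> d \<le> \<bar>B $$ (i, 0) mod d\<bar>"
    using lp i unfolding least_pivot_def by (metis bot_nat_0.extremum_strict gr0I)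
  moreover have "\<bar>B $$ (i, 0) mod d\<bar> < d" using d0 by simp
  ultimately show ?thesis by auto
qed (use d in simp)

lemma least_pivot_dvd_row:
  assumes A: "A \<in> carrier_mat n n" and lp: "least_pivot n A d"
    and B: "mat_equivalent n A B" and d: "B $$ (0, 0) = d" and j: "j < n"
  shows "d dvd B $$ (0, j)"
proof (cases "j = 0")
  case False
  define q where "q = B $$ (0, j) div d"
  have Bc: "B \<in> carrier_mat n n" using mat_equivalent_carrier[OF A B] .
  have d0: "0 < d" using lp by (simp add: least_pivot_def)
  have "mat_equivalent n A (B * addrow_mat n (- q) 0 j)"
    using False j by (intro mat_equivalent_mult_right A B addrow_mat_GL_int) auto
  moreover have "B * addrow_mat n (- q) 0 j = addcol (- q) j 0 B"
    using j by (subst addcol_mat[OF Bc]) auto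
  moreover have "addcol (- q) j 0 B $$ (0, j) = B $$ (0, j) mod d"
    using j Bc d by (simp add: q_def minus_div_mult_eq_mod[symmetric])
  ultimately have "B $$ (0, j) mod d = 0 \<or> d \<le> \<bar>B $$ (0, j) mod d\<bar>"
    using lp j unfolding least_pivot_def by (metis bot_nat_0.extremum_strict gr0I)
  moreover have "\<bar>B $$ (0, j) mod d\<bar> < d" using d0 by simp
  ultimately show ?thesis by auto
qed (use d in simp)

lemma smith_diag_Cons:
  "smith_diag (1 + m) (d # s)
    = four_block_mat (mat 1 1 (\<lambda>_. d)) (0\<^sub>m 1 m) (0\<^sub>m m 1) (smith_diag m s)"
  by (rule eq_matI) (auto simp: smith_diag_def nth_Cons')

text \<open>
  With the least pivot \<open>d\<close> in the corner, its row and column are cleared. The pivot also divides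
  the remaining block: adding a row of that block to row 0 keeps the corner \<open>d\<close> and moves the row
  into the range of the previous divisibility lemmas. Integer combinations preserve divisibility
  by \<open>d\<close>, so \<open>d\<close> divides the first invariant factor that induction supplies for the block.
\<close>

theorem smith_normal_form_exists:
  assumes "A \<in> carrier_mat n n"
  shows "\<exists>s. length s \<le> n \<and> (\<forall>i<length s. 0 < s ! i) \<and>
    (\<forall>i. Suc i < length s \<longrightarrow> s ! i dvd s ! Suc i) \<and> mat_equivalent n A (smith_diag n s)"
  using assms
proof (induction n arbitrary: A)
  case 0
  have "A = smith_diag 0 []" using 0 by (intro eq_matI) (auto simp: smith_diag_def)
  thus ?case using mat_equivalent_refl[OF 0] by (intro exI[of _ "[]"]) simp
next
  case (Suc m)
  show ?case
  proof (cases "A = 0\<^sub>m (Suc m) (Suc m)")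
    case True
    hence "A = smith_diag (Suc m) []" by (intro eq_matI) (auto simp: smith_diag_def)
    thus ?thesis using mat_equivalent_refl[OF Suc.prems] by (intro exI[of _ "[]"]) simp
  next
    case False
    have A: "A \<in> carrier_mat (1 + m) (1 + m)" using Suc.prems by simp
    from False obtain B d where B: "mat_equivalent (1 + m) A B" and d: "B $$ (0, 0) = d"
      and lp: "least_pivot (1 + m) A d"
      using exists_least_pivot[OF Suc.prems] by auto
    have d0: "0 < d" using lp by (simp add: least_pivot_def)
    have Bc: "B \<in> carrier_mat (1 + m) (1 + m)" using mat_equivalent_carrier[OF A B] .
    define C where "C = mat 1 1 (\<lambda>_. d)"
    define U where "U = mat 1 m (\<lambda>(_, j). B $$ (0, Suc j) div d)"
    define V where "V = mat m 1 (\<lambda>(i, _). B $$ (Suc i, 0) div d)"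
    define Z where "Z = mat m m (\<lambda>(i, j). B $$ (Suc i, Suc j))"
    define D where "D = Z - V * (C * U)"
    have c: "C \<in> carrier_mat 1 1" "U \<in> carrier_mat 1 m" "V \<in> carrier_mat m 1" "Z \<in> carrier_mat m m"
      unfolding C_def U_def V_def Z_def by auto
    have Dc: "D \<in> carrier_mat m m" unfolding D_def using c by (intro minus_carrier_mat mult_carrier_mat)
    have "B = four_block_mat C (C * U) (V * C) Z"
      using Bc c d least_pivot_dvd_row[OF A lp B d] least_pivot_dvd_column[OF A lp B d]
      by (intro eq_matI) (auto simp: C_def U_def V_def Z_def scalar_prod_def)
    hence E: "mat_equivalent (1 + m) A (four_block_mat C (0\<^sub>m 1 m) (0\<^sub>m m 1) D)"
      unfolding D_def using block_elimination[OF A _ c] B by simp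
    (* Row 0 of E is (d, 0, ..., 0) and column 0 of the added row is 0, so after the addition
       row 0 consists of d followed by that row of D. *)
    have dvdD: "d dvd D $$ (i, j)" if ij: "i < m" "j < m" for i j
    proof -
      let ?E = "four_block_mat C (0\<^sub>m 1 m) (0\<^sub>m m 1) D"
      let ?F = "addrow_mat (1 + m) 1 0 (Suc i) * ?E"
      have Ec: "?E \<in> carrier_mat (1 + m) (1 + m)" using c Dc by (intro four_block_carrier_mat)
      have F: "?F = addrow 1 0 (Suc i) ?E"
        using ij by (subst addrow_mat[OF Ec]) auto
      have FE: "mat_equivalent (1 + m) A ?F"
        using ij by (intro mat_equivalent_mult_left A E addrow_mat_GL_int) auto
      have "?F $$ (0, 0) = d" unfolding F using c Dc ij by (simp add: C_def)
      from least_pivot_dvd_row[OF A lp FE this, of "Suc j"] ij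
      have "d dvd ?F $$ (0, Suc j)" by simp
      thus ?thesis unfolding F using c Dc ij by simp
    qed
    obtain s where s: "length s \<le> m" "\<forall>i<length s. 0 < s ! i"
      "\<forall>i. Suc i < length s \<longrightarrow> s ! i dvd s ! Suc i" "mat_equivalent m D (smith_diag m s)"
      using Suc.IH[OF Dc] by blast
    from s(4) obtain P Q where P: "P \<in> GL_int m" and Q: "Q \<in> GL_int m" and PQ: "smith_diag m s = P * D * Q"
      unfolding mat_equivalent_def by blast
    note PQc = GL_int_carrier[OF P] GL_int_carrier[OF Q]
    have dvd0: "d dvd s ! 0" if "s \<noteq> []"
    proof -
      have m: "0 < m" "0 < length s" using that s(1) by (cases s; simp)+
      have "d dvd (P * D) $$ (0, k)" if "k < m" for k
        using that m PQc Dc dvdD by (intro dvd_mat_mult_entries) auto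
      hence "d dvd (P * D * Q) $$ (0, 0)"
        using m PQc Dc by (intro dvd_mat_mult_entries) auto
      thus ?thesis unfolding PQ[symmetric] using m by (simp add: smith_diag_def)
    qed
    let ?b = "\<lambda>M. four_block_mat (1\<^sub>m 1) (0\<^sub>m 1 m) (0\<^sub>m m 1) M"
    have "mat_equivalent (1 + m) A (?b P * four_block_mat C (0\<^sub>m 1 m) (0\<^sub>m m 1) D * ?b Q)"
      by (intro mat_equivalent_mult A E block_diag_GL_int P Q)
    moreover have "?b P * four_block_mat C (0\<^sub>m 1 m) (0\<^sub>m m 1) D * ?b Q
        = four_block_mat C (0\<^sub>m 1 m) (0\<^sub>m m 1) (P * D * Q)"
      using c Dc PQc by (simp add: block_diag_mult)
    ultimately have "mat_equivalent (Suc m) A (smith_diag (Suc m) (d # s))"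
      using smith_diag_Cons[of m d s] by (simp add: PQ C_def)
    moreover have "\<forall>i<length (d # s). 0 < (d # s) ! i"
      using s(2) d0 by (auto simp: nth_Cons')
    moreover have "\<forall>i. Suc i < length (d # s) \<longrightarrow> (d # s) ! i dvd (d # s) ! Suc i"
      using s(3) dvd0 by (auto simp: nth_Cons split: nat.split)
    ultimately show ?thesis using s(1) by (intro exI[of _ "d # s"]) simp
  qed
qed


section \<open>The field of p-adic numbers\<close>

text \<open>
  The valuation is defined through the reduced fraction; computing it from an arbitrary one makes
  the laws for products and sums consequences of those for the multiplicity on the integers.
\<close>

lemma padic_val_of_fraction:
  assumes "prime p" and "a \<noteq> 0" and "b \<noteq> 0"
  shows "padic_val p (of_int a / of_int b) =
    ereal (real (multiplicity (int p) a) - real (multiplicity (int p) b))"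
proof -
  obtain c d where cd: "quotient_of (of_int a / of_int b) = (c, d)"
    by fastforce
  have d: "d > 0" using quotient_of_denom_pos[OF cd] .
  have eq: "(of_int a / of_int b :: rat) = of_int c / of_int d"
    using quotient_of_div[OF cd] .
  have "rat_of_int (a * d) = rat_of_int (c * b)"
    using eq d assms by (simp add: field_simps)
  hence ad: "a * d = c * b" by linarith
  hence c: "c \<noteq> 0" using assms d by auto
  have pr: "prime_elem (int p)" using assms(1) by simp
  have "multiplicity (int p) a + multiplicity (int p) d = multiplicity (int p) c + multiplicity (int p) b"
    using ad prime_elem_multiplicity_mult_distrib[OF pr] assms c d
    by (metis less_irrefl)
  hence "real (multiplicity (int p) a) + real (multiplicity (int p) d)
      = real (multiplicity (int p) c) + real (multiplicity (int p) b)"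
    by (metis of_nat_add)
  thus ?thesis using assms unfolding padic_val_def cd by simp
qed

lemma padic_val_0 [simp]: "padic_val p 0 = \<infinity>"
  by (simp add: padic_val_def)

lemma padic_val_of_int:
  assumes "c \<noteq> 0"
  shows "padic_val p (of_int c) = ereal (real (multiplicity (int p) c))"
  using assms by (simp add: padic_val_def)

lemma padic_val_minus [simp]: "padic_val p (- x) = padic_val p x"
proof -
  have "multiplicity (int p) (- a) = multiplicity (int p) a" for a
    by (rule multiplicity_cong) simp_all
  thus ?thesis by (simp add: padic_val_def rat_uminus_code split: prod.split)
qed

lemma rat_as_fraction:
  obtains a b where "(x::rat) = of_int a / of_int b" "b \<noteq> 0"
proof -
  obtain a b where ab: "quotient_of x = (a, b)" by fastforce
  show thesis using that[of a b] quotient_of_div[OF ab] quotient_of_denom_pos[OF ab] by simp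
qed

lemma padic_val_mult:
  assumes "prime p"
  shows "padic_val p (x * y) = padic_val p x + padic_val p y"
proof (cases "x = 0 \<or> y = 0")
  case True
  thus ?thesis by (auto simp: padic_val_def)
next
  case False
  obtain a b where x: "x = of_int a / of_int b" "b \<noteq> 0" by (rule rat_as_fraction)
  obtain c d where y: "y = of_int c / of_int d" "d \<noteq> 0" by (rule rat_as_fraction)
  have nz: "a \<noteq> 0" "c \<noteq> 0" using False x y by auto
  have xy: "x * y = of_int (a * c) / of_int (b * d)" by (simp add: x y)
  have pr: "prime_elem (int p)" using assms by simp
  show ?thesis
    unfolding xy unfolding x y using nz x(2) y(2) assms
    by (simp add: padic_val_of_fraction prime_elem_multiplicity_mult_distrib[OF pr] del: of_int_mult)
qed

lemma padic_val_add_ge: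
  assumes "prime p" and "v \<le> padic_val p x" and "v \<le> padic_val p y"
  shows "v \<le> padic_val p (x + y)"
proof (cases "x = 0 \<or> y = 0 \<or> x + y = 0")
  case True
  thus ?thesis using assms by auto
next
  case False
  obtain a b where x: "x = of_int a / of_int b" "b \<noteq> 0" by (rule rat_as_fraction)
  obtain c d where y: "y = of_int c / of_int d" "d \<noteq> 0" by (rule rat_as_fraction)
  let ?m = "multiplicity (int p)"
  have nz: "a \<noteq> 0" "c \<noteq> 0" using False x y by auto
  have s: "x + y = of_int (a * d + c * b) / of_int (b * d)"
    using x(2) y(2) by (simp add: x y field_simps)
  have snz: "a * d + c * b \<noteq> 0" using False s by (metis of_int_0 div_0)
  have pr: "prime_elem (int p)" using assms by simp
  define k where "k = min (?m (a * d)) (?m (c * b))"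
  have "int p ^ k dvd a * d" "int p ^ k dvd c * b"
    unfolding k_def by (auto intro: multiplicity_dvd')
  hence "int p ^ k dvd a * d + c * b" by simp
  moreover have "\<not> is_unit (int p)" using assms(1) by (auto dest: not_prime_unit)
  ultimately have ge: "k \<le> ?m (a * d + c * b)"
    using snz by (intro multiplicity_geI) auto
  have m: "?m (a * d) = ?m a + ?m d" "?m (c * b) = ?m c + ?m b" "?m (b * d) = ?m b + ?m d"
    using prime_elem_multiplicity_mult_distrib[OF pr] nz x(2) y(2) by auto
  have "padic_val p (x + y) = ereal (real (?m (a * d + c * b)) - real (?m (b * d)))"
    unfolding s using assms(1) snz x(2) y(2) by (intro padic_val_of_fraction) auto
  moreover have "padic_val p x = ereal (real (?m a) - real (?m b))"
    "padic_val p y = ereal (real (?m c) - real (?m d))"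
    unfolding x(1) y(1) using assms(1) x(2) y(2) nz by (simp_all add: padic_val_of_fraction)
  moreover have "real (?m a) - real (?m b) \<le> real (?m (a * d + c * b)) - real (?m (b * d))
      \<or> real (?m c) - real (?m d) \<le> real (?m (a * d + c * b)) - real (?m (b * d))"
    using ge unfolding k_def m by linarith
  ultimately have "padic_val p x \<le> padic_val p (x + y) \<or> padic_val p y \<le> padic_val p (x + y)"
    by simp
  thus ?thesis using assms(2,3) order_trans by blast
qed

lemma padic_val_diff_ge:
  assumes "prime p" and "v \<le> padic_val p x" and "v \<le> padic_val p y"
  shows "v \<le> padic_val p (x - y)"
  using padic_val_add_ge[OF assms(1,2), of "- y"] assms(3) by simp

lemma padic_val_mult_ge:
  assumes "prime p" and "ereal a \<le> padic_val p x" and "ereal b \<le> padic_val p y"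
  shows "ereal (a + b) \<le> padic_val p (x * y)"
  using add_mono[OF assms(2,3)] by (simp add: padic_val_mult[OF assms(1)])

text \<open>
  In the ultrametric inequality the strictly smaller valuation wins: otherwise
  \<open>x = (x + y) - y\<close> would have larger valuation than it has.
\<close>

lemma padic_val_add_dominated:
  assumes "prime p" and "padic_val p x < padic_val p y"
  shows "padic_val p (x + y) = padic_val p x"
proof (rule antisym)
  show "padic_val p x \<le> padic_val p (x + y)"
    using assms by (intro padic_val_add_ge) auto
  show "padic_val p (x + y) \<le> padic_val p x"
  proof (rule ccontr)
    assume "\<not> ?thesis"
    then have lt: "padic_val p x < padic_val p (x + y)" by simp
    define v where "v = min (padic_val p (x + y)) (padic_val p y)"
    have "v \<le> padic_val p (x + y - y)"
      unfolding v_def by (intro padic_val_diff_ge assms(1)) auto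
    with lt assms(2) show False by (auto simp: v_def min_le_iff_disj)
  qed
qed

lemma padic_nullI:
  assumes "\<And>N::nat. \<exists>m. \<forall>i\<ge>m. ereal (real N) \<le> padic_val p (u i)"
  shows "u \<in> padic_null p"
  unfolding padic_null_def mem_Collect_eq Lim_PInfty
proof
  fix r :: real
  obtain N :: nat where "r \<le> real N" using real_arch_simple by blast
  moreover obtain m where "\<forall>i\<ge>m. ereal (real N) \<le> padic_val p (u i)" using assms by blast
  ultimately show "\<exists>m. \<forall>i\<ge>m. ereal r \<le> padic_val p (u i)"
    by (meson ereal_less_eq(3) order_trans)
qed

lemma padic_nullD:
  assumes "u \<in> padic_null p"
  shows "\<exists>m. \<forall>i\<ge>m. ereal r \<le> padic_val p (u i)"
  using assms unfolding padic_null_def Lim_PInfty by blast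

lemma padic_cauchyI:
  assumes "\<And>N::nat. \<exists>m. \<forall>i\<ge>m. \<forall>j\<ge>m. ereal (real N) \<le> padic_val p (u i - u j)"
  shows "u \<in> padic_cauchy p"
  using assms unfolding padic_cauchy_def by blast

lemma padic_cauchyD:
  assumes "u \<in> padic_cauchy p"
  shows "\<exists>m. \<forall>i\<ge>m. \<forall>j\<ge>m. ereal r \<le> padic_val p (u i - u j)"
proof -
  obtain N :: nat where "r \<le> real N" using real_arch_simple by blast
  moreover obtain m where "\<forall>i\<ge>m. \<forall>j\<ge>m. ereal (real N) \<le> padic_val p (u i - u j)"
    using assms unfolding padic_cauchy_def by blast
  ultimately show ?thesis
    by (meson ereal_less_eq(3) order_trans)
qed

lemma padic_null_subset_cauchy:
  assumes "prime p"
  shows "padic_null p \<subseteq> padic_cauchy p"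
proof
  fix u assume u: "u \<in> padic_null p"
  show "u \<in> padic_cauchy p"
  proof (rule padic_cauchyI)
    fix N :: nat
    obtain m where "\<forall>i\<ge>m. ereal (real N) \<le> padic_val p (u i)" using padic_nullD[OF u] by blast
    thus "\<exists>m. \<forall>i\<ge>m. \<forall>j\<ge>m. ereal (real N) \<le> padic_val p (u i - u j)"
      using padic_val_diff_ge[OF assms] by blast
  qed
qed

lemma const_padic_cauchy [simp]: "(\<lambda>_. c) \<in> padic_cauchy p"
  by (auto simp: padic_cauchy_def)

lemma padic_cauchy_add:
  assumes "prime p" and u: "u \<in> padic_cauchy p" and w: "w \<in> padic_cauchy p"
  shows "(\<lambda>i. u i + w i) \<in> padic_cauchy p"
proof (rule padic_cauchyI)
  fix N :: nat
  obtain m1 where m1: "\<forall>i\<ge>m1. \<forall>j\<ge>m1. ereal (real N) \<le> padic_val p (u i - u j)"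
    using padic_cauchyD[OF u] by blast
  obtain m2 where m2: "\<forall>i\<ge>m2. \<forall>j\<ge>m2. ereal (real N) \<le> padic_val p (w i - w j)"
    using padic_cauchyD[OF w] by blast
  have "ereal (real N) \<le> padic_val p (u i + w i - (u j + w j))"
    if "i \<ge> max m1 m2" "j \<ge> max m1 m2" for i j
    using padic_val_add_ge[OF assms(1), of "ereal (real N)" "u i - u j" "w i - w j"] m1 m2 that
    by (simp add: algebra_simps)
  thus "\<exists>m. \<forall>i\<ge>m. \<forall>j\<ge>m. ereal (real N) \<le> padic_val p (u i + w i - (u j + w j))" by blast
qed

lemma padic_cauchy_bounded:
  assumes "prime p" and u: "u \<in> padic_cauchy p"
  shows "\<exists>b m. \<forall>i\<ge>m. ereal b \<le> padic_val p (u i)"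
proof -
  obtain m where m: "\<forall>i\<ge>m. \<forall>j\<ge>m. ereal 0 \<le> padic_val p (u i - u j)"
    using padic_cauchyD[OF u] by blast
  obtain b where b: "b \<le> 0" "ereal b \<le> padic_val p (u m)"
  proof (cases "padic_val p (u m)")
    case (real r)
    thus ?thesis using that[of "min r 0"] by simp
  next
    case PInf
    thus ?thesis using that[of 0] by simp
  next
    case MInf
    thus ?thesis by (auto simp: padic_val_def split: if_splits)
  qed
  have "ereal b \<le> padic_val p (u i)" if "i \<ge> m" for i
  proof -
    have "ereal b \<le> padic_val p (u i - u m)"
      using m that b(1) by (meson ereal_less_eq(3) order_refl order_trans)
    from padic_val_add_ge[OF assms(1) b(2) this] show ?thesis by simp
  qed
  thus ?thesis by blast
qed

lemma padic_cauchy_mult: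
  assumes p: "prime p" and u: "u \<in> padic_cauchy p" and w: "w \<in> padic_cauchy p"
  shows "(\<lambda>i. u i * w i) \<in> padic_cauchy p"
proof (rule padic_cauchyI)
  fix N :: nat
  obtain b k where b: "\<forall>i\<ge>k. ereal b \<le> padic_val p (u i)" using padic_cauchy_bounded[OF p u] by blast
  obtain c l where c: "\<forall>i\<ge>l. ereal c \<le> padic_val p (w i)" using padic_cauchy_bounded[OF p w] by blast
  obtain m1 where m1: "\<forall>i\<ge>m1. \<forall>j\<ge>m1. ereal (real N - c) \<le> padic_val p (u i - u j)"
    using padic_cauchyD[OF u] by blast
  obtain m2 where m2: "\<forall>i\<ge>m2. \<forall>j\<ge>m2. ereal (real N - b) \<le> padic_val p (w i - w j)"
    using padic_cauchyD[OF w] by blast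
  have "ereal (real N) \<le> padic_val p (u i * w i - u j * w j)"
    if "i \<ge> Max {k, l, m1, m2}" "j \<ge> Max {k, l, m1, m2}" for i j
  proof -
    have "ereal (b + (real N - b)) \<le> padic_val p (u i * (w i - w j))"
      using b m2 that by (intro padic_val_mult_ge p) auto
    moreover have "ereal (c + (real N - c)) \<le> padic_val p (w j * (u i - u j))"
      using c m1 that by (intro padic_val_mult_ge p) auto
    ultimately have "ereal (real N) \<le> padic_val p (u i * (w i - w j) + w j * (u i - u j))"
      by (intro padic_val_add_ge p) auto
    thus ?thesis by (simp add: algebra_simps)
  qed
  thus "\<exists>m. \<forall>i\<ge>m. \<forall>j\<ge>m. ereal (real N) \<le> padic_val p (u i * w i - u j * w j)" by blast
qed

lemma padic_null_add:
  assumes "prime p" and u: "u \<in> padic_null p" and w: "w \<in> padic_null p"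
  shows "(\<lambda>i. u i + w i) \<in> padic_null p"
proof (rule padic_nullI)
  fix N :: nat
  obtain m1 where "\<forall>i\<ge>m1. ereal (real N) \<le> padic_val p (u i)" using padic_nullD[OF u] by blast
  moreover obtain m2 where "\<forall>i\<ge>m2. ereal (real N) \<le> padic_val p (w i)" using padic_nullD[OF w] by blast
  ultimately have "\<forall>i\<ge>max m1 m2. ereal (real N) \<le> padic_val p (u i + w i)"
    using padic_val_add_ge[OF assms(1)] by simp
  thus "\<exists>m. \<forall>i\<ge>m. ereal (real N) \<le> padic_val p (u i + w i)" by blast
qed

lemma padic_null_mult:
  assumes p: "prime p" and u: "u \<in> padic_cauchy p" and w: "w \<in> padic_null p"
  shows "(\<lambda>i. u i * w i) \<in> padic_null p"
proof (rule padic_nullI)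
  fix N :: nat
  obtain b k where b: "\<forall>i\<ge>k. ereal b \<le> padic_val p (u i)" using padic_cauchy_bounded[OF p u] by blast
  obtain m where m: "\<forall>i\<ge>m. ereal (real N - b) \<le> padic_val p (w i)" using padic_nullD[OF w] by blast
  have "ereal (real N) \<le> padic_val p (u i * w i)" if "i \<ge> max k m" for i
    using padic_val_mult_ge[OF p, of b "u i" "real N - b" "w i"] b m that by simp
  thus "\<exists>m. \<forall>i\<ge>m. ereal (real N) \<le> padic_val p (u i * w i)" by blast
qed

text \<open>
  A Cauchy sequence that is not null has, beyond the index where its differences have valuation
  at least \<open>N\<close>, a term of valuation less than \<open>N\<close>; that term dominates the differences, so all
  later terms have its valuation.
\<close>

lemma padic_val_bounded_of_not_null:
  assumes p: "prime p" and u: "u \<in> padic_cauchy p" and nn: "u \<notin> padic_null p"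
  shows "\<exists>b m. \<forall>i\<ge>m. padic_val p (u i) \<le> ereal b"
proof -
  obtain N :: nat where N: "\<And>m. \<exists>i\<ge>m. \<not> ereal (real N) \<le> padic_val p (u i)"
    using nn padic_nullI by meson
  obtain m where m: "\<forall>i\<ge>m. \<forall>j\<ge>m. ereal (real N) \<le> padic_val p (u i - u j)"
    using padic_cauchyD[OF u] by blast
  obtain k where k: "k \<ge> m" "padic_val p (u k) < ereal (real N)" using N[of m] by auto
  have "padic_val p (u i) \<le> ereal (real N)" if "i \<ge> m" for i
  proof -
    have "padic_val p (u k) < padic_val p (u i - u k)"
      using k m that by (meson less_le_trans)
    from padic_val_add_dominated[OF p this] show ?thesis using k by simp
  qed
  thus ?thesis by blast
qed

text \<open>
  Only finitely many terms can vanish, so the convention \<open>inverse 0 = 0\<close> does no harm. The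
  Cauchy property comes from \<open>1/x - 1/y = (y - x)/(x y)\<close> and the bound on the valuations of \<open>x\<close>
  and \<open>y\<close>.
\<close>

lemma padic_cauchy_inverse:
  assumes p: "prime p" and u: "u \<in> padic_cauchy p" and nn: "u \<notin> padic_null p"
  shows "(\<lambda>i. inverse (u i)) \<in> padic_cauchy p"
    and "(\<lambda>i. u i * inverse (u i) - 1) \<in> padic_null p"
proof -
  obtain b k where b: "\<forall>i\<ge>k. padic_val p (u i) \<le> ereal b"
    using padic_val_bounded_of_not_null[OF assms] by blast
  have nz: "u i \<noteq> 0" if "i \<ge> k" for i using b that by fastforce
  have inv: "ereal (- b) \<le> padic_val p (inverse (u i))" if "i \<ge> k" for i
  proof -
    have "padic_val p (u i) + padic_val p (inverse (u i)) = padic_val p (u i * inverse (u i))"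
      by (simp add: padic_val_mult[OF p])
    also have "\<dots> = 0" using nz[OF that] padic_val_of_int[of 1 p] by simp
    finally show ?thesis using b that
      by (cases "padic_val p (u i)"; cases "padic_val p (inverse (u i))") fastforce+
  qed
  show "(\<lambda>i. inverse (u i)) \<in> padic_cauchy p"
  proof (rule padic_cauchyI)
    fix N :: nat
    obtain m where m: "\<forall>i\<ge>m. \<forall>j\<ge>m. ereal (real N + 2 * b) \<le> padic_val p (u i - u j)"
      using padic_cauchyD[OF u] by blast
    have "ereal (real N) \<le> padic_val p (inverse (u i) - inverse (u j))"
      if "i \<ge> max k m" "j \<ge> max k m" for i j
    proof -
      have "ereal (- b + - b + (real N + 2 * b))
          \<le> padic_val p (inverse (u i) * inverse (u j) * (u j - u i))"
        using inv m that by (intro padic_val_mult_ge p) auto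
      moreover have "inverse (u i) * inverse (u j) * (u j - u i) = inverse (u i) - inverse (u j)"
        using nz that by (simp add: field_simps)
      ultimately show ?thesis by simp
    qed
    thus "\<exists>m. \<forall>i\<ge>m. \<forall>j\<ge>m. ereal (real N) \<le> padic_val p (inverse (u i) - inverse (u j))" by blast
  qed
  show "(\<lambda>i. u i * inverse (u i) - 1) \<in> padic_null p"
  proof (rule padic_nullI)
    fix N :: nat
    have "\<forall>i\<ge>k. ereal (real N) \<le> padic_val p (u i * inverse (u i) - 1)" using nz by simp
    thus "\<exists>m. \<forall>i\<ge>m. ereal (real N) \<le> padic_val p (u i * inverse (u i) - 1)" by blast
  qed
qed

lemma padic_cauchy_ring_simps [simp]:
  "carrier (padic_cauchy_ring p) = padic_cauchy p"
  "\<one>\<^bsub>padic_cauchy_ring p\<^esub> = (\<lambda>_. 1)"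
  "\<zero>\<^bsub>padic_cauchy_ring p\<^esub> = (\<lambda>_. 0)"
  "u \<otimes>\<^bsub>padic_cauchy_ring p\<^esub> w = (\<lambda>i. u i * w i)"
  "u \<oplus>\<^bsub>padic_cauchy_ring p\<^esub> w = (\<lambda>i. u i + w i)"
  by (simp_all add: padic_cauchy_ring_def)

lemma padic_cauchy_ring_cring:
  assumes p: "prime p"
  shows "cring (padic_cauchy_ring p)"
proof (rule cringI)
  have neg: "(\<lambda>i. - u i) \<in> padic_cauchy p" if "u \<in> padic_cauchy p" for u
    using padic_cauchy_mult[OF p const_padic_cauchy[of "- 1"] that] by simp
  show "abelian_group (padic_cauchy_ring p)"
  proof (rule abelian_groupI)
    fix u assume "u \<in> carrier (padic_cauchy_ring p)"
    thus "\<exists>w\<in>carrier (padic_cauchy_ring p). w \<oplus>\<^bsub>padic_cauchy_ring p\<^esub> u = \<zero>\<^bsub>padic_cauchy_ring p\<^esub>"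
      using neg by (intro bexI[of _ "\<lambda>i. - u i"]) auto
  qed (auto simp: padic_cauchy_add[OF p] algebra_simps)
  show "comm_monoid (padic_cauchy_ring p)"
    by (rule comm_monoidI) (auto simp: padic_cauchy_mult[OF p] algebra_simps)
qed (auto simp: algebra_simps)

text \<open>
  Every Cauchy sequence that is not null is invertible modulo null sequences, hence an ideal
  that properly contains the null sequences contains 1.
\<close>

lemma padic_null_maximalideal:
  assumes p: "prime p"
  shows "maximalideal (padic_null p) (padic_cauchy_ring p)"
proof -
  let ?R = "padic_cauchy_ring p"
  interpret R: cring ?R using p by (rule padic_cauchy_ring_cring)
  have I: "ideal (padic_null p) ?R"
  proof (rule idealI)
    show "ring ?R" by (rule R.ring_axioms)
    show "subgroup (padic_null p) (add_monoid ?R)"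
    proof (rule R.add.subgroupI)
      show "padic_null p \<subseteq> carrier ?R" using padic_null_subset_cauchy[OF p] by simp
      show "padic_null p \<noteq> {}" using padic_nullI[of p "\<lambda>_. 0"] by auto
      fix u assume u: "u \<in> padic_null p"
      hence uc: "u \<in> padic_cauchy p" using padic_null_subset_cauchy[OF p] by blast
      have n: "(\<lambda>i. - u i) \<in> padic_null p"
        using padic_null_mult[OF p const_padic_cauchy[of "- 1"] u] by simp
      hence nc: "(\<lambda>i. - u i) \<in> padic_cauchy p" using padic_null_subset_cauchy[OF p] by blast
      have "\<ominus>\<^bsub>?R\<^esub> u = (\<lambda>i. - u i)"
        using R.minus_equality[of "\<lambda>i. - u i" u] uc nc by simp
      thus "\<ominus>\<^bsub>?R\<^esub> u \<in> padic_null p" using n by simp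
    next
      fix u w assume "u \<in> padic_null p" "w \<in> padic_null p"
      thus "u \<oplus>\<^bsub>?R\<^esub> w \<in> padic_null p" using padic_null_add[OF p] by simp
    qed
    fix a x assume "a \<in> padic_null p" "x \<in> carrier ?R"
    hence "(\<lambda>i. x i * a i) \<in> padic_null p" using padic_null_mult[OF p] by simp
    thus "x \<otimes>\<^bsub>?R\<^esub> a \<in> padic_null p" "a \<otimes>\<^bsub>?R\<^esub> x \<in> padic_null p"
      by (simp_all add: mult.commute)
  qed
  show ?thesis
  proof (rule maximalidealI[OF I])
    have "(\<lambda>_. 1) \<notin> padic_null p"
    proof
      assume "(\<lambda>_. 1) \<in> padic_null p"
      from padic_nullD[OF this, of 1] show False
        using padic_val_of_int[of 1 p] by auto
    qed
    moreover have "(\<lambda>_. 1) \<in> carrier ?R" by simp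
    ultimately show "carrier ?R \<noteq> padic_null p" by blast
  next
    fix J assume J: "ideal J ?R" and sub: "padic_null p \<subseteq> J" "J \<subseteq> carrier ?R"
    show "J = padic_null p \<or> J = carrier ?R"
    proof (rule disjCI)
      assume "J \<noteq> carrier ?R"
      show "J = padic_null p"
      proof (rule ccontr)
        assume "J \<noteq> padic_null p"
        then obtain u where u: "u \<in> J" "u \<notin> padic_null p" using sub by auto
        interpret J: ideal J ?R by (rule J)
        have uc: "u \<in> padic_cauchy p" using u sub by auto
        note inv = padic_cauchy_inverse[OF p uc u(2)]
        have "(\<lambda>i. u i * inverse (u i)) \<in> J"
          using J.I_r_closed[OF u(1)] inv(1) by simp
        moreover have "(\<lambda>i. - 1 * (u i * inverse (u i) - 1)) \<in> padic_null p"
          by (rule padic_null_mult[OF p const_padic_cauchy inv(2)])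
        hence "(\<lambda>i. 1 - u i * inverse (u i)) \<in> J" using sub by auto
        ultimately have "(\<lambda>i. u i * inverse (u i)) \<oplus>\<^bsub>?R\<^esub> (\<lambda>i. 1 - u i * inverse (u i)) \<in> J"
          by (rule J.a_closed)
        hence "\<one>\<^bsub>?R\<^esub> \<in> J" by simp
        with J.one_imp_carrier \<open>J \<noteq> carrier ?R\<close> show False by simp
      qed
    qed
  qed
qed

lemma Qp_field:
  assumes "prime p"
  shows "field (Qp p)"
  unfolding Qp_def
  using maximalideal.quotient_is_field[OF padic_null_maximalideal padic_cauchy_ring_cring] assms
  by blast

abbreviation padic_of_rat :: "nat \<Rightarrow> rat \<Rightarrow> padic" where
  "padic_of_rat p q \<equiv> padic_null p +>\<^bsub>padic_cauchy_ring p\<^esub> (\<lambda>_. q)"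

lemma padic_of_rat_hom:
  assumes "prime p"
  shows "padic_of_rat p q \<in> carrier (Qp p)"
    and "padic_of_rat p 1 = \<one>\<^bsub>Qp p\<^esub>"
    and "padic_of_rat p (q + q') = padic_of_rat p q \<oplus>\<^bsub>Qp p\<^esub> padic_of_rat p q'"
proof -
  interpret I: ideal "padic_null p" "padic_cauchy_ring p"
    using padic_null_maximalideal[OF assms] by (rule maximalideal.axioms(1))
  note hom = I.rcos_ring_hom[folded Qp_def]
  show "padic_of_rat p q \<in> carrier (Qp p)" using ring_hom_closed[OF hom] by simp
  show "padic_of_rat p 1 = \<one>\<^bsub>Qp p\<^esub>" using ring_hom_one[OF hom] by simp
  show "padic_of_rat p (q + q') = padic_of_rat p q \<oplus>\<^bsub>Qp p\<^esub> padic_of_rat p q'"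
    using ring_hom_add[OF hom, of "\<lambda>_. q" "\<lambda>_. q'"] by simp
qed

text \<open>
  The representatives are \<open>w + q\<close> with \<open>w\<close> null. If \<open>q\<close> is nonzero, it eventually dominates \<open>w\<close>, so the
  valuations are eventually constant; if \<open>q = 0\<close>, they tend to infinity by definition.
\<close>

lemma Qp_val_of_rat:
  assumes p: "prime p"
  shows "Qp_val p (padic_of_rat p q) = padic_val p q"
proof -
  have mem: "u \<in> padic_of_rat p q \<longleftrightarrow> (\<exists>w\<in>padic_null p. u = (\<lambda>i. w i + q))" for u
    by (simp add: a_r_coset_def' )
  have lim: "(\<lambda>i. padic_val p (w i + q)) \<longlonglongrightarrow> padic_val p q" if w: "w \<in> padic_null p" for w
  proof (cases "q = 0")
    case True
    thus ?thesis using w by (simp add: padic_null_def)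
  next
    case False
    then obtain r where r: "padic_val p q = ereal r" by (auto simp: padic_val_def)
    obtain m where m: "\<forall>i\<ge>m. ereal (r + 1) \<le> padic_val p (w i)" using padic_nullD[OF w] by blast
    have "padic_val p (w i + q) = padic_val p q" if "i \<ge> m" for i
    proof -
      have "padic_val p q < padic_val p (w i)"
        using m that r by (metis ereal_less(2) less_ereal.simps(1) less_add_one less_le_trans)
      from padic_val_add_dominated[OF p this] show ?thesis by (simp add: add.commute)
    qed
    hence "eventually (\<lambda>i. padic_val p (w i + q) = padic_val p q) sequentially"
      by (auto simp: eventually_sequentially)
    thus ?thesis by (rule tendsto_eventually)
  qed
  have "(\<lambda>_. 0) \<in> padic_null p" by (rule padic_nullI) simp
  hence q: "(\<lambda>_. q) \<in> padic_of_rat p q" using mem[of "\<lambda>_. q"] by force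
  show ?thesis
    unfolding Qp_val_def
  proof (rule the_equality)
    show "\<forall>u\<in>padic_of_rat p q. (\<lambda>i. padic_val p (u i)) \<longlonglongrightarrow> padic_val p q"
      using mem lim by auto
    fix v assume "\<forall>u\<in>padic_of_rat p q. (\<lambda>i. padic_val p (u i)) \<longlonglongrightarrow> v"
    with q have "(\<lambda>_::nat. padic_val p q) \<longlonglongrightarrow> v" by fastforce
    thus "v = padic_val p q" by (simp add: LIMSEQ_const_iff)
  qed
qed


section \<open>Integer polynomials over a field\<close>

abbreviation (in ring) ring_of_int :: "int \<Rightarrow> 'a" where
  "ring_of_int c \<equiv> [c] \<cdot> \<one>"

context cring begin

lemma ring_of_int_closed: "ring_of_int c \<in> carrier R"
  by simp

lemma ring_of_int_add: "ring_of_int (a + b) = ring_of_int a \<oplus> ring_of_int b"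
  by (simp add: add.int_pow_mult)

lemma ring_of_int_minus: "ring_of_int (- a) = \<ominus> ring_of_int a"
  by (simp add: add.int_pow_neg)

lemma ring_of_int_mult: "ring_of_int (a * b) = ring_of_int a \<otimes> ring_of_int b"
proof -
  have "ring_of_int a \<otimes> ring_of_int b = [a] \<cdot> (\<one> \<otimes> ring_of_int b)"
    by (rule add_pow_ldistr_int) simp_all
  also have "\<dots> = ring_of_int (b * a)"
    by (simp add: add.int_pow_pow)
  finally show ?thesis by (simp add: mult.commute)
qed

lemma ring_of_int_0: "ring_of_int 0 = \<zero>"
  by (simp add: add_pow_def)

lemma ring_of_int_sum:
  assumes "finite S"
  shows "ring_of_int (sum f S) = (\<Oplus>k\<in>S. ring_of_int (f k))"
  using assms by (induction S) (auto simp: ring_of_int_0 ring_of_int_add)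

text \<open>
  The image of an integer polynomial, written as a list with the leading coefficient first, which
  is how elements of the ring of polynomials over \<open>R\<close> are represented.
\<close>

definition list_of_int_poly :: "int poly \<Rightarrow> 'a list" where
  "list_of_int_poly f = map ring_of_int (rev (coeffs f))"

lemma coeff_list_of_int_poly: "coeff (list_of_int_poly f) i = ring_of_int (Polynomial.coeff f i)"
proof (cases "i < length (coeffs f)")
  case True
  hence "coeff (list_of_int_poly f) i = ring_of_int (rev (coeffs f) ! (length (coeffs f) - 1 - i))"
    unfolding list_of_int_poly_def by (subst coeff_nth) simp_all
  also have "rev (coeffs f) ! (length (coeffs f) - 1 - i) = Polynomial.coeff f i"
    using True by (simp add: rev_nth nth_coeffs_coeff Suc_diff_Suc)
  finally show ?thesis .
next
  case False
  hence "Polynomial.coeff f i = 0"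
    by (cases "f = 0") (auto simp: length_coeffs_degree intro: coeff_eq_0)
  thus ?thesis using False coeff_length[of "list_of_int_poly f" i] by (simp add: list_of_int_poly_def ring_of_int_0)
qed

end

context field begin

text \<open>
  For a monic polynomial the leading coefficient maps to 1 and does not vanish, so the list needs
  no normalization even in positive characteristic.
\<close>

lemma list_of_monic_int_poly:
  assumes "Polynomial.lead_coeff f = 1"
  shows "list_of_int_poly f \<in> carrier (poly_ring R)" "list_of_int_poly f \<noteq> []"
proof -
  have f: "f \<noteq> 0" using assms by auto
  thus ne: "list_of_int_poly f \<noteq> []" by (simp add: list_of_int_poly_def)
  have "hd (list_of_int_poly f) = ring_of_int (last (coeffs f))"
    unfolding list_of_int_poly_def using f by (simp add: hd_map hd_rev)
  also have "\<dots> = \<one>" using assms f by (simp add: last_coeffs_eq_coeff_degree)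
  finally show "list_of_int_poly f \<in> carrier (poly_ring R)"
    unfolding univ_poly_carrier[symmetric]
    by (auto simp: polynomial_def list_of_int_poly_def)
qed

lemma list_of_int_poly_mult:
  assumes "Polynomial.lead_coeff f = 1" "Polynomial.lead_coeff g = 1"
  shows "list_of_int_poly (f * g) = list_of_int_poly f \<otimes>\<^bsub>poly_ring R\<^esub> list_of_int_poly g"
proof -
  interpret UP: domain "poly_ring R" using univ_poly_is_domain[OF carrier_is_subring] .
  have fg: "Polynomial.lead_coeff (f * g) = 1" using assms by (simp add: lead_coeff_mult)
  note c = list_of_monic_int_poly(1)[OF assms(1)] list_of_monic_int_poly(1)[OF assms(2)]
    list_of_monic_int_poly(1)[OF fg]
  have sub: "set (list_of_int_poly f) \<subseteq> carrier R" "set (list_of_int_poly g) \<subseteq> carrier R"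
    by (auto simp: list_of_int_poly_def)
  have "coeff (list_of_int_poly (f * g)) i = coeff (poly_mult (list_of_int_poly f) (list_of_int_poly g)) i" for i
    unfolding poly_mult_coeff[OF sub] coeff_list_of_int_poly coeff_mult
    by (simp add: ring_of_int_sum ring_of_int_mult)
  hence "coeff (list_of_int_poly (f * g)) = coeff (list_of_int_poly f \<otimes>\<^bsub>poly_ring R\<^esub> list_of_int_poly g)"
    by (auto simp: univ_poly_mult)
  moreover have "polynomial (carrier R) (list_of_int_poly (f * g))"
    "polynomial (carrier R) (list_of_int_poly f \<otimes>\<^bsub>poly_ring R\<^esub> list_of_int_poly g)"
    using c UP.m_closed univ_poly_carrier by blast+
  ultimately show ?thesis using coeff_iff_polynomial_cond by blast
qed

text \<open>
  Induction on the linear factors: multiplying by a monic linear factor adds its root to the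
  multiset of roots.
\<close>

lemma roots_split_int_poly:
  "roots (list_of_int_poly (\<Prod>a\<leftarrow>as. [:- a, 1:])) = image_mset ring_of_int (mset as)"
proof (induction as)
  case Nil
  have "list_of_int_poly 1 = [\<one>]" by (simp add: list_of_int_poly_def)
  moreover have "list_of_int_poly 1 \<in> carrier (poly_ring R)"
    by (rule list_of_monic_int_poly) simp
  ultimately show ?case using degree_zero_imp_empty_roots[of "[\<one>]"] by simp
next
  case (Cons a as)
  have m: "Polynomial.lead_coeff (\<Prod>a\<leftarrow>as. [:- a, 1:]) = (1::int)"
    by (induction as) (auto simp: lead_coeff_mult simp del: mult_pCons_left)
  have "list_of_int_poly [:- a, 1:] = [\<one>, \<ominus> ring_of_int a]"
    by (simp add: list_of_int_poly_def ring_of_int_minus)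
  hence "list_of_int_poly (\<Prod>a\<leftarrow>a # as. [:- a, 1:])
      = [\<one>, \<ominus> ring_of_int a] \<otimes>\<^bsub>poly_ring R\<^esub> list_of_int_poly (\<Prod>a\<leftarrow>as. [:- a, 1:])"
    using list_of_int_poly_mult[of "[:- a, 1:]", OF _ m] by simp
  thus ?case
    using poly_mult_degree_one_monic_imp_same_roots[OF ring_of_int_closed list_of_monic_int_poly[OF m], of a]
    by (simp add: Cons.IH)
qed

text \<open>
  Over the field itself, \<open>x - a\<close> is a monic irreducible polynomial that vanishes at \<open>a\<close>, and the minimal
  polynomial is unique.
\<close>

lemma Irr_over_carrier:
  assumes a: "a \<in> carrier R"
  shows "Irr (carrier R) a = [\<one>, \<ominus> a]"
proof -
  note sf = carrier_is_subfield
  have alg: "(algebraic over (carrier R)) a" using algebraic_self[OF carrier_is_subring a] .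
  have c: "[\<one>, \<ominus> a] \<in> carrier (poly_ring R)"
    using a unfolding univ_poly_carrier[symmetric] polynomial_def by simp
  have "eval [\<one>, \<ominus> a] a = \<zero>" using a by (simp add: r_neg)
  moreover have "pirreducible (carrier R) [\<one>, \<ominus> a]"
    using degree_one_imp_pirreducible[OF sf c] by simp
  ultimately show ?thesis
    using minimal_polynomial_is_unique[OF sf a alg] IrrE[OF sf a alg] c by (metis list.sel(1))
qed

lemma finite_dimension_carrier: "finite_dimension (carrier R) (carrier R)"
  using finite_dimensionI[OF dimension_one[OF carrier_is_subfield]] .

end


section \<open>Eigenvalues and rank of a Smith normal form\<close>

lemma smith_diag_carrier [simp]: "smith_diag n s \<in> carrier_mat n n"
  by (simp add: smith_diag_def)

lemma char_poly_smith_diag: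
  assumes "length s \<le> n"
  shows "char_poly (smith_diag n s) = (\<Prod>a\<leftarrow>s @ replicate (n - length s) 0. [:- a, 1:])"
proof -
  have "diag_mat (smith_diag n s) = s @ replicate (n - length s) 0"
    using assms by (intro nth_equalityI) (auto simp: diag_mat_def smith_diag_def nth_append)
  moreover have "upper_triangular (smith_diag n s)" by (auto simp: smith_diag_def)
  ultimately show ?thesis using char_poly_upper_triangular[OF smith_diag_carrier] by metis
qed

lemma nonzero_eigenvalues_smith_diag:
  assumes "field K" and "length s \<le> n" and nz: "\<And>a. a \<in> set s \<Longrightarrow> [a] \<cdot>\<^bsub>K\<^esub> \<one>\<^bsub>K\<^esub> \<noteq> \<zero>\<^bsub>K\<^esub>"
  shows "nonzero_eigenvalues K (smith_diag n s) = mset (map (\<lambda>a. [a] \<cdot>\<^bsub>K\<^esub> \<one>\<^bsub>K\<^esub>) s)"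
proof -
  interpret K: field K by fact
  have "K.roots (char_poly_over K (smith_diag n s))
      = image_mset K.ring_of_int (mset (s @ replicate (n - length s) 0))"
    using K.roots_split_int_poly[of "s @ replicate (n - length s) 0"]
    by (simp add: char_poly_over_def K.list_of_int_poly_def char_poly_smith_diag[OF assms(2)])
  moreover have "filter_mset (\<lambda>x. x \<noteq> \<zero>\<^bsub>K\<^esub>) (image_mset K.ring_of_int (mset s)) = image_mset K.ring_of_int (mset s)"
    using nz by (intro filter_mset_eq_conv[THEN iffD2]) (auto dest: sym)
  ultimately show ?thesis
    unfolding nonzero_eigenvalues_def by (simp add: K.ring_of_int_0 filter_mset_image_mset image_replicate_mset)
qed

text \<open>
  The columns that carry an invariant factor form a maximal independent set of columns. They are
  independent because they are also rows of the nonsingular diagonal matrix in which the zeros on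
  the diagonal are replaced by ones; the other columns vanish.
\<close>

lemma int_rank_smith_diag:
  assumes l: "length s \<le> n" and nz: "0 \<notin> set s"
  shows "int_rank (smith_diag n s) = length s"
proof -
  let ?M = "map_mat rat_of_int (smith_diag n s)"
  let ?N = "map_mat rat_of_int (smith_diag n (s @ replicate (n - length s) 1))"
  interpret vec_space "TYPE(rat)" n .
  have M: "?M \<in> carrier_mat n n" and N: "?N \<in> carrier_mat n n" by simp_all
  let ?S = "col ?M ` {..<length s}"
  have inj: "inj_on (col ?M) {..<length s}"
  proof (rule inj_onI)
    fix i j assume ij: "i \<in> {..<length s}" "j \<in> {..<length s}" and eq: "col ?M i = col ?M j"
    have "col ?M i $ i = col ?M j $ i" using eq by simp
    moreover have "s ! i \<noteq> 0" using ij nz by (metis lessThan_iff nth_mem)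
    ultimately show "i = j" using ij l by (auto simp: smith_diag_def split: if_splits)
  qed
  have "?S \<subseteq> set (rows ?N)"
  proof
    fix v assume "v \<in> ?S"
    then obtain i where i: "i < length s" "v = col ?M i" by auto
    have "v = row ?N i" unfolding i(2)
      using i(1) l by (intro eq_vecI) (auto simp: smith_diag_def nth_append)
    moreover have "row ?N i \<in> set (rows ?N)" using i(1) l by (auto simp: rows_def smith_diag_def)
    ultimately show "v \<in> set (rows ?N)" by simp
  qed
  moreover have "lin_indpt (set (rows ?N))"
  proof (rule upper_triangular_imp_lin_indpt_rows[OF N])
    show "upper_triangular ?N" by (auto simp: smith_diag_def)
    show "0 \<notin> set (diag_mat ?N)"
      using l nz by (auto simp: diag_mat_def smith_diag_def nth_append in_set_conv_nth split: if_splits)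
  qed
  ultimately have ind: "lin_indpt ?S" using subset_li_is_li by blast
  have sub: "?S \<subseteq> set (cols ?M)" using l by (auto simp: cols_def smith_diag_def)
  have max: "T = ?S" if T: "?S \<subseteq> T" "T \<subseteq> set (cols ?M)" "lin_indpt T" for T
  proof -
    have "set (cols ?M) \<subseteq> carrier_vec n"
      using cols_dim[of ?M] unfolding carrier_matD(1)[OF M] .
    hence "T \<subseteq> carrier_vec n" using T(2) by blast
    moreover have "(UNIV :: rat set) \<noteq> {0}" by (metis UNIV_I singletonD zero_neq_one)
    ultimately have zero: "0\<^sub>v n \<notin> T" using T(3) zero_nin_lin_indpt[of T] by auto
    have "T \<subseteq> ?S"
    proof
      fix v assume v: "v \<in> T"
      then obtain j where j: "j < n" "v = col ?M j"
        using T(2) by (auto simp: cols_def smith_diag_def)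
      have "j < length s"
      proof (rule ccontr)
        assume "\<not> j < length s"
        hence "v = 0\<^sub>v n" unfolding j(2) using j(1) by (intro eq_vecI) (auto simp: smith_diag_def)
        thus False using v zero by simp
      qed
      thus "v \<in> ?S" using j by blast
    qed
    thus ?thesis using T(1) by blast
  qed
  have "maximal ?S (\<lambda>T. T \<subseteq> set (cols ?M) \<and> lin_indpt T)"
    unfolding maximal_def using sub ind max by blast
  from rank_card_indpt[OF M this] show ?thesis
    using inj by (simp add: int_rank_def card_image smith_diag_def)
qed


section \<open>Integers in the p-adic numbers and their extended valuation\<close>

lemma Qp_of_int:
  assumes p: "prime p"
  shows "[c] \<cdot>\<^bsub>Qp p\<^esub> \<one>\<^bsub>Qp p\<^esub> = padic_of_rat p (of_int c)"
proof -
  interpret K: field "Qp p" using p by (rule Qp_field)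
  note hom = padic_of_rat_hom[OF p]
  show ?thesis
  proof (induction c rule: int_induct[of _ 1])
    case base
    show ?case using hom(2) by simp
  next
    case (step1 i)
    thus ?case using K.ring_of_int_add[of i 1] hom(2,3) by simp
  next
    case (step2 i)
    have "K.ring_of_int (i - 1) \<oplus>\<^bsub>Qp p\<^esub> \<one>\<^bsub>Qp p\<^esub> = K.ring_of_int i"
      using K.ring_of_int_add[of "i - 1" 1] by simp
    also have "\<dots> = padic_of_rat p (of_int (i - 1)) \<oplus>\<^bsub>Qp p\<^esub> \<one>\<^bsub>Qp p\<^esub>"
      using step2.IH hom(2) hom(3)[of "of_int (i - 1)" 1] by simp
    finally show ?case
      using K.add.right_cancel[OF K.one_closed K.ring_of_int_closed hom(1)] by blast
  qed
qed

text \<open>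
  The minimal polynomial of the image of \<open>c\<close> over the p-adic numbers is linear with constant term
  \<open>-c\<close>, and \<open>c\<close> and \<open>-c\<close> have the same valuation.
\<close>

lemma ext_val_Qp_of_int:
  assumes p: "prime p"
  shows "ext_val p (Qp p) id ([c] \<cdot>\<^bsub>Qp p\<^esub> \<one>\<^bsub>Qp p\<^esub>) = padic_val p (of_int c)"
proof -
  interpret K: field "Qp p" using p by (rule Qp_field)
  let ?a = "K.ring_of_int c"
  have a: "?a \<in> carrier (Qp p)" by (rule K.ring_of_int_closed)
  have "K.const_term ([\<one>\<^bsub>Qp p\<^esub>] @ [\<ominus>\<^bsub>Qp p\<^esub> ?a]) = \<ominus>\<^bsub>Qp p\<^esub> ?a"
    using a by (intro K.const_term_eq_last) auto
  hence const: "K.const_term [\<one>\<^bsub>Qp p\<^esub>, \<ominus>\<^bsub>Qp p\<^esub> ?a] = K.ring_of_int (- c)"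
    by (simp add: K.ring_of_int_minus)
  have "inv_into (carrier (Qp p)) id (K.ring_of_int (- c)) = K.ring_of_int (- c)"
    using inv_into_f_f[of id "carrier (Qp p)" "K.ring_of_int (- c)"] K.ring_of_int_closed by simp
  hence "ext_val p (Qp p) id ?a = Qp_val p (K.ring_of_int (- c))"
    by (simp add: ext_val_def K.Irr_over_carrier[OF a] const one_ereal_def[symmetric])
  also have "\<dots> = padic_val p (of_int c)"
    using Qp_val_of_rat[OF p, of "of_int (- c)"] by (simp add: Qp_of_int[OF p])
  finally show ?thesis .
qed

lemma Qp_of_int_nonzero:
  assumes p: "prime p" and c: "(c::int) \<noteq> 0"
  shows "[c] \<cdot>\<^bsub>Qp p\<^esub> \<one>\<^bsub>Qp p\<^esub> \<noteq> \<zero>\<^bsub>Qp p\<^esub>"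
proof
  interpret K: field "Qp p" using p by (rule Qp_field)
  assume "K.ring_of_int c = \<zero>\<^bsub>Qp p\<^esub>"
  hence "K.ring_of_int c = K.ring_of_int 0" by (simp only: K.ring_of_int_0)
  hence "padic_val p (of_int c) = padic_val p (of_int 0)"
    using ext_val_Qp_of_int[OF p] by metis
  thus False using c by (simp add: padic_val_of_int)
qed

lemma finite_Qp_extension_self:
  assumes "prime p"
  shows "finite_Qp_extension p (Qp p) id"
proof -
  interpret K: field "Qp p" using assms by (rule Qp_field)
  show ?thesis
    unfolding finite_Qp_extension_def
    using K.field_axioms K.finite_dimension_carrier by (simp add: ring_hom_def)
qed

text \<open>
  The field of p-adic numbers itself serves as the extension: the nonzero eigenvalues are the
  invariant factors, and divisibility orders their valuations.
\<close>

lemma p_correspondent_smith_diag: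
  assumes p: "prime p" and l: "length s \<le> n" and pos: "\<forall>i<length s. 0 < s ! i"
    and dvd: "\<forall>i. Suc i < length s \<longrightarrow> s ! i dvd s ! Suc i"
  shows "p_correspondent p (smith_diag n s)"
proof -
  let ?K = "Qp p"
  let ?M = "smith_diag n s"
  let ?e = "\<lambda>a. [a] \<cdot>\<^bsub>?K\<^esub> \<one>\<^bsub>?K\<^esub>"
  have pos': "0 < a" if "a \<in> set s" for a using pos that by (auto simp: in_set_conv_nth)
  have rank: "int_rank ?M = length s" using l pos' by (intro int_rank_smith_diag) auto
  have "1\<^sub>m n * ?M * 1\<^sub>m n = ?M"
    using left_mult_one_mat[OF smith_diag_carrier] right_mult_one_mat[OF smith_diag_carrier] by metis
  hence inv: "invariant_factors ?M s"
    unfolding invariant_factors_def carrier_matD(1)[OF smith_diag_carrier]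
    using l pos dvd one_GL_int by blast
  have eig: "mset (map ?e s) = nonzero_eigenvalues ?K ?M"
    using Qp_of_int_nonzero[OF p] pos'
    by (intro nonzero_eigenvalues_smith_diag[symmetric] Qp_field p l) force
  have val: "map (ext_val p ?K id) (map ?e s) = map (\<lambda>a. padic_val p (of_int a)) s"
    by (simp add: ext_val_Qp_of_int[OF p])
  have "padic_val p (of_int (s ! i)) \<le> padic_val p (of_int (s ! Suc i))" if i: "Suc i < length s" for i
  proof -
    have "s ! i \<noteq> 0" "s ! Suc i \<noteq> 0" using pos i by (metis Suc_lessD less_irrefl)+
    moreover have "multiplicity (int p) (s ! i) \<le> multiplicity (int p) (s ! Suc i)"
      using dvd i \<open>s ! Suc i \<noteq> 0\<close> by (intro dvd_imp_multiplicity_le) auto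
    ultimately show ?thesis by (simp add: padic_val_of_int)
  qed
  hence "sorted (map (ext_val p ?K id) (map ?e s))"
    unfolding val by (simp add: sorted_iff_nth_Suc)
  thus ?thesis
    unfolding p_correspondent_def using finite_Qp_extension_self[OF p] inv rank eig
    by (intro exI[of _ ?K] exI[of _ id] exI[of _ s] exI[of _ "map ?e s"])
      (simp add: ext_val_Qp_of_int[OF p])
qed

theorem lemma1:
  fixes A :: "int mat" and n p :: nat
  assumes "A \<in> carrier_mat n n" and "prime p"
  shows "\<exists>P\<in>GL_int n. \<exists>Q\<in>GL_int n. p_correspondent p (P * A * Q)"
proof -
  obtain s where s: "length s \<le> n" "\<forall>i<length s. 0 < s ! i"
    "\<forall>i. Suc i < length s \<longrightarrow> s ! i dvd s ! Suc i" "mat_equivalent n A (smith_diag n s)"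
    using smith_normal_form_exists[OF assms(1)] by blast
  from s(4) obtain P Q where "P \<in> GL_int n" "Q \<in> GL_int n" "smith_diag n s = P * A * Q"
    unfolding mat_equivalent_def by blast
  with p_correspondent_smith_diag[OF assms(2) s(1-3)] show ?thesis by metis
qed

end
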